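(* Let $\Gamma=(V,H,w)$ be a weighted hypergraph with $V=\{1,\dots,n\}$, let $\Gamma^*=(H,V,w^\top)$ be its dual hypergraph, let $Z\subset\mathbb{R}^n$ be the hypergraphic zonotope of $\Gamma$, and let $\square=[-1,1]^n$ be the unit ball of $\mathbb{R}^n$ in the $\ell^\infty$ norm. Then the nonzero eigenvalues of the 1-Laplacian on $\Gamma$, the nonzero eigenvalues of the $\infty$-Laplacian on $\Gamma^*$, and the contact values between $Z$ and $\square$ coincide, i.e. $$\mathrm{Contact}(\square,Z)=\mathrm{spec}_{\ne0}(\Delta_1(\Gamma))=\mathrm{spec}_{\ne0}(\Delta_\infty(\Gamma^* )).$$
   Context: A weighted hypergraph $\Gamma=(V,H,w)$ is a real matrix $w=(w_{ih})_{i\in V,h\in H}$ with $V$ (vertices) and $H$ (hyperedges) finite. Put $v_h=(w_{ih})_{i\in V}\in\mathbb{R}^V$ and let $W=(w_{hi})_{h\in H,i\in V}$, $w_{hi}:=w_{ih}$, be the edge-vertex incidence matrix, so $Wx=(\langle v_h,x\rangle)_{h\in H}$. The hypergraphic zonotope of $\Gamma$ is the Minkowski sum $Z=\sum_{h\in H}[-v_h,v_h]$. $\mathrm{spec}_{\neq0}(\Delta_1(\Gamma))$ is the set of $\lambda\ne0$ for which there is $x\in\mathbb{R}^V\setminus\{0\}$ with $\partial\|Wx\|_1\cap\lambda\,\partial\|x\|_1\neq\varnothing$. $\mathrm{spec}_{\neq0}(\Delta_\infty(\Gamma^* ))$ is the set of $\lambda\neq0$ for which there is $y\in\mathbb{R}^H\setminus\{0\}$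 with $\partial\|W^\top y\|_\infty\cap\lambda\,\partial\|y\|_\infty\ne\varnothing$. Here $\partial\|Wx\|_1$ denotes the subdifferential at $x$ of the convex function $x\mapsto\|Wx\|_1$, and similarly for the others. For convex sets $K,L\subseteq\mathbb{R}^n$ with the origin in their relative interiors and relative boundaries $\partial K,\partial L$: $\partial K$ and $\partial L$ are tangent at $x$ if $x\in\partial K\cap\partial L$ and there is a common supporting hyperplane $H_0\ni x$ of both $K$ and $L$ at $x$ with $K\not\subseteq H_0$ and $L\not\subseteq H_0$. Define $\mathrm{Contact}(K,L)=\{\lambda>0:\partial K\text{ and }\lambda\,\partial L\text{ are tangent at some point}\}$, where $\lambda\,\partial L=\{\lambda y:y\in\partial L\}$.
   Formalization: The formal theorem has Contact(Z,□) in place of Contact(□,Z): with the dilation acting on the second argument, the displayed order gives the reciprocals of the eigenvalues (e.g. n=1 with one hyperedge of weight 2 gives {1/2} instead of {2}). *)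

theory Defs
  imports "HOL-Analysis.Analysis"
begin

text \<open>
  A weighted hypergraph with vertices \<open>'v\<close> and hyperedges \<open>'h\<close> is its weight matrix
  \<open>w :: real^'h^'v\<close>, where \<open>w $ i $ h\<close> is the weight of vertex \<open>i\<close> in hyperedge \<open>h\<close>;
  the vector of hyperedge \<open>h\<close> is \<open>column h w\<close>.
\<close>

type_synonym ('v, 'h) hypergraph = "real^'h^'v"

definition dual_hypergraph :: "('v::finite, 'h::finite) hypergraph \<Rightarrow> ('h, 'v) hypergraph"
  where "dual_hypergraph w = transpose w"

definition edge_vertex_matrix :: "('v::finite, 'h::finite) hypergraph \<Rightarrow> real^'v^'h"
  where "edge_vertex_matrix w = transpose w"

text \<open>The sum is the Minkowski sum of sets.\<close>

definition hypergraphic_zonotope :: "('v::finite, 'h::finite) hypergraph \<Rightarrow> (real^'v) set"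
  where "hypergraphic_zonotope w = (\<Sum>h\<in>UNIV. closed_segment (- column h w) (column h w))"

definition l1_norm :: "real^'n::finite \<Rightarrow> real"
  where "l1_norm x = (\<Sum>i\<in>UNIV. \<bar>x $ i\<bar>)"

definition subdifferential :: "('a::real_inner \<Rightarrow> real) \<Rightarrow> 'a \<Rightarrow> 'a set"
  where "subdifferential f x = {g. \<forall>z. f z \<ge> f x + g \<bullet> (z - x)}"

definition nonzero_spec_Laplacian_1 :: "('v::finite, 'h::finite) hypergraph \<Rightarrow> real set"
  where "nonzero_spec_Laplacian_1 w =
    {\<mu>. \<mu> \<noteq> 0 \<and> (\<exists>x. x \<noteq> 0 \<and>
      subdifferential (\<lambda>z. l1_norm (edge_vertex_matrix w *v z)) x \<inter>
        (*\<^sub>R) \<mu> ` subdifferential l1_norm x \<noteq> {})}"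

definition nonzero_spec_Laplacian_infinity :: "('v::finite, 'h::finite) hypergraph \<Rightarrow> real set"
  where "nonzero_spec_Laplacian_infinity w =
    {\<mu>. \<mu> \<noteq> 0 \<and> (\<exists>x. x \<noteq> 0 \<and>
      subdifferential (\<lambda>z. infnorm (edge_vertex_matrix w *v z)) x \<inter>
        (*\<^sub>R) \<mu> ` subdifferential infnorm x \<noteq> {})}"

text \<open>
  The hyperplane \<open>{y. a \<bullet> y = b}\<close> supports \<open>K\<close> at \<open>x\<close>: it passes through \<open>x\<close> and \<open>K\<close> lies
  in one of its two closed half-spaces.
\<close>

definition supports_at :: "'a::euclidean_space \<Rightarrow> real \<Rightarrow> 'a set \<Rightarrow> 'a \<Rightarrow> bool"
  where "supports_at a b K x \<longleftrightarrow>
    a \<noteq> 0 \<and> a \<bullet> x = b \<and> (K \<subseteq> {y. a \<bullet> y \<le> b} \<or> K \<subseteq> {y. a \<bullet> y \<ge> b})"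

text \<open>For convex sets having the origin in their relative interiors.\<close>

definition tangent_at :: "'a::euclidean_space set \<Rightarrow> 'a set \<Rightarrow> 'a \<Rightarrow> bool"
  where "tangent_at K L x \<longleftrightarrow> x \<in> rel_frontier K \<inter> rel_frontier L \<and>
    (\<exists>a b. supports_at a b K x \<and> supports_at a b L x \<and>
      \<not> K \<subseteq> {y. a \<bullet> y = b} \<and> \<not> L \<subseteq> {y. a \<bullet> y = b})"

text \<open>
  For \<open>\<mu> > 0\<close> the \<open>\<mu>\<close>-dilate of the relative boundary of \<open>L\<close> is the relative boundary of
  \<open>\<mu>L\<close>. The definition is not symmetric: the dilation acts on the second argument, so exchanging
  the arguments replaces each contact value by its reciprocal.
\<close>

definition Contact :: "'a::euclidean_space set \<Rightarrow> 'a set \<Rightarrow> real set"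
  where "Contact K L = {\<mu>. \<mu> > 0 \<and> (\<exists>x. tangent_at K ((*\<^sub>R) \<mu> ` L) x)}"

end

theory Submission
  imports Defs
begin

text \<open>
  A positively homogeneous convex function is the support function \<open>x \<mapsto> max {k \<bullet> x | k \<in> K}\<close>
  of a closed convex set \<open>K\<close>, and its subdifferential at \<open>x\<close> is the face of \<open>K\<close> exposed by \<open>x\<close>
  (\<open>subdifferential_support_function\<close>). Both equalities of the theorem follow from reading
  \<open>\<partial>f x \<inter> \<mu> \<partial>g x \<noteq> {}\<close> in this way.

  For the contact values, the zonotope is the image of the cube under the incidence matrix, so it has
  the support function \<open>x \<mapsto> \<parallel>Wx\<parallel>\<^sub>1\<close>, while the cube has the support function \<open>\<parallel>x\<parallel>\<^sub>1\<close>. A common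
  subgradient \<open>p \<in> \<partial>\<parallel>Wx\<parallel>\<^sub>1 \<inter> \<mu> \<partial>\<parallel>x\<parallel>\<^sub>1\<close> is then a common point of the zonotope and the
  \<open>\<mu>\<close>-dilated cube at which \<open>x\<close> is normal to both: \<open>x\<close> is the normal of a common supporting hyperplane
  and \<open>p\<close> is the point of tangency (\<open>Contact_eq_nonzero_eigenvalues\<close>).

  For the duality, an eigenvalue of \<open>\<parallel>Ax\<parallel>\<close> relative to \<open>\<parallel>x\<parallel>\<close> amounts to a critical pair: a vector
  \<open>x\<close> and a dual vector \<open>y\<close>, both in the unit balls, such that \<open>y \<bullet> Ax = \<mu>\<close> while neither \<open>Ax\<close> nor
  \<open>A\<^sup>T y\<close> has norm greater than \<open>\<mu>\<close> (\<open>nonzero_eigenvalues_dual_norms\<close>). This condition is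
  invariant under exchanging \<open>x\<close> with \<open>y\<close>, \<open>A\<close> with \<open>A\<^sup>T\<close>, and each norm with its dual. The exchange
  turns the \<open>1\<close>-Laplacian of the hypergraph into the \<open>\<infinity>\<close>-Laplacian of the dual hypergraph,
  because the \<open>\<ell>\<^sup>1\<close> and \<open>\<ell>\<^sup>\<infinity>\<close> norms are dual to each other.
\<close>

section \<open>Support functions and their subdifferentials\<close>

definition support_function :: "'a::euclidean_space set \<Rightarrow> ('a \<Rightarrow> real) \<Rightarrow> bool"
  where "support_function K f \<longleftrightarrow>
    (\<forall>x. (\<forall>k\<in>K. k \<bullet> x \<le> f x) \<and> (\<exists>k\<in>K. k \<bullet> x = f x))"

lemma support_function_ge: "support_function K f \<Longrightarrow> k \<in> K \<Longrightarrow> k \<bullet> x \<le> f x"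
  by (simp add: support_function_def)

lemma support_function_attained:
  assumes "support_function K f"
  obtains k where "k \<in> K" "k \<bullet> x = f x"
  using assms by (auto simp: support_function_def)

text \<open>
  Testing the subgradient inequality at \<open>0\<close> and at \<open>2x\<close> forces \<open>g \<bullet> x = f x\<close>, after which it says that
  \<open>g \<bullet> z \<le> f z\<close> for all \<open>z\<close>. A point outside \<open>K\<close> violates this for the normal \<open>z\<close> of a
  separating hyperplane.
\<close>

lemma subdifferential_support_function:
  assumes supp: "support_function K f" and "closed K" "convex K"
  shows "subdifferential f x = {g \<in> K. g \<bullet> x = f x}"
proof (intro equalityI subsetI)
  fix g assume "g \<in> subdifferential f x"
  then have sub: "f z \<ge> f x + g \<bullet> (z - x)" for z
    by (simp add: subdifferential_def)
  have "f 0 = 0"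
    using support_function_attained[OF supp, of 0] by force
  then have "f x \<le> g \<bullet> x"
    using sub[of 0] by simp
  moreover have "f (2 *\<^sub>R x) \<le> 2 * f x"
  proof -
    obtain k where "k \<in> K" "k \<bullet> (2 *\<^sub>R x) = f (2 *\<^sub>R x)"
      using support_function_attained[OF supp] .
    then show ?thesis
      using support_function_ge[OF supp, of k x] by simp
  qed
  then have "g \<bullet> x \<le> f x"
    using sub[of "2 *\<^sub>R x"] by (simp add: inner_diff_right)
  ultimately have eq: "g \<bullet> x = f x"
    by simp
  have "g \<in> K"
  proof (rule ccontr)
    assume "g \<notin> K"
    then obtain a b where ab: "a \<bullet> g < b" "\<And>k. k \<in> K \<Longrightarrow> b < a \<bullet> k"
      using separating_hyperplane_closed_point[OF \<open>convex K\<close> \<open>closed K\<close>] by blast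
    obtain k where "k \<in> K" "k \<bullet> (- a) = f (- a)"
      using support_function_attained[OF supp] .
    then show False
      using sub[of "- a"] ab eq by (force simp: inner_diff_right inner_commute)
  qed
  with eq show "g \<in> {g \<in> K. g \<bullet> x = f x}"
    by simp
next
  fix g assume "g \<in> {g \<in> K. g \<bullet> x = f x}"
  then show "g \<in> subdifferential f x"
    using support_function_ge[OF supp] by (auto simp: subdifferential_def inner_diff_right)
qed

lemma support_function_linear_image:
  fixes A :: "real^'n::finite^'m::finite"
  assumes supp: "support_function K f"
  shows "support_function ((*v) (transpose A) ` K) (\<lambda>x. f (A *v x))"
  unfolding support_function_def
proof (intro allI conjI ballI)
  fix x g assume "g \<in> (*v) (transpose A) ` K"
  then show "g \<bullet> x \<le> f (A *v x)"
    using support_function_ge[OF supp] by (auto simp: dot_lmul_matrix)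
next
  fix x
  obtain k where "k \<in> K" "k \<bullet> (A *v x) = f (A *v x)"
    using support_function_attained[OF supp] .
  then show "\<exists>g\<in>(*v) (transpose A) ` K. g \<bullet> x = f (A *v x)"
    by (auto simp: dot_lmul_matrix)
qed

lemma compact_matrix_image:
  fixes A :: "real^'n::finite^'m::finite"
  shows "compact K \<Longrightarrow> compact ((*v) A ` K)"
  by (intro compact_continuous_image linear_continuous_on matrix_vector_mul_bounded_linear)

section \<open>Contact values as eigenvalues\<close>

definition nonzero_eigenvalues :: "('a::real_inner \<Rightarrow> real) \<Rightarrow> ('a \<Rightarrow> real) \<Rightarrow> real set"
  where "nonzero_eigenvalues f g =
    {\<mu>. \<mu> \<noteq> 0 \<and> (\<exists>x. x \<noteq> 0 \<and> subdifferential f x \<inter> (*\<^sub>R) \<mu> ` subdifferential g x \<noteq> {})}"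

text \<open>
  If \<open>p\<close> were in the relative interior, the segment from \<open>0\<close> to \<open>p\<close> could be prolonged inside \<open>K\<close> beyond
  \<open>p\<close>, across the hyperplane.
\<close>

lemma rel_frontier_supporting_hyperplane:
  fixes K :: "'a::euclidean_space set"
  assumes "convex K" "0 \<in> K" "p \<in> K" and le: "\<And>y. y \<in> K \<Longrightarrow> x \<bullet> y \<le> x \<bullet> p" and "x \<bullet> p > 0"
  shows "p \<in> rel_frontier K"
proof -
  have "p \<notin> rel_interior K"
  proof
    assume "p \<in> rel_interior K"
    then obtain e where "e > 1" "(1 - e) *\<^sub>R 0 + e *\<^sub>R p \<in> K"
      using convex_rel_interior_iff[OF \<open>convex K\<close>, of p] \<open>0 \<in> K\<close> by blast
    then have "e *\<^sub>R p \<in> K"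
      by simp
    then have "e * (x \<bullet> p) \<le> x \<bullet> p"
      using le[of "e *\<^sub>R p"] by simp
    with \<open>e > 1\<close> \<open>x \<bullet> p > 0\<close> show False
      by simp
  qed
  then show ?thesis
    using \<open>p \<in> K\<close> closure_subset by (auto simp: rel_frontier_def)
qed

lemma zero_in_symmetric_convex:
  assumes "convex K" "x \<in> K" "- x \<in> K"
  shows "(0::'a::real_vector) \<in> K"
  using convexD[OF assms, of "1/2" "1/2"] by simp

text \<open>
  The two ways in which a hyperplane can support a set differ by the sign of its normal. A supporting
  hyperplane of the symmetric set \<open>K\<close> that does not contain \<open>K\<close> misses the origin. So both sets lie on
  the side of the origin, which they share, and the normal \<open>x\<close> pointing away from it serves both.
\<close>

lemma supports_at_outward_normal:
  fixes K L :: "'a::euclidean_space set"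
  assumes K: "0 \<in> K" "uminus ` K = K" and L: "0 \<in> L"
    and supp: "supports_at a b K p" "supports_at a b L p" and not_sub: "\<not> K \<subseteq> {y. a \<bullet> y = b}"
  obtains x where "x \<noteq> 0" "\<And>y. y \<in> K \<union> L \<Longrightarrow> x \<bullet> y \<le> x \<bullet> p"
proof -
  have b: "a \<noteq> 0" "a \<bullet> p = b"
    using supp(1) by (auto simp: supports_at_def)
  have "b \<noteq> 0"
  proof
    assume "b = 0"
    have "a \<bullet> y = 0" if "y \<in> K" for y
    proof -
      have "- y \<in> K"
        using that K(2) by blast
      then have "(a \<bullet> y \<le> 0 \<and> a \<bullet> (- y) \<le> 0) \<or> (a \<bullet> y \<ge> 0 \<and> a \<bullet> (- y) \<ge> 0)"
        using supp(1) that \<open>b = 0\<close> unfolding supports_at_def subset_iff mem_Collect_eq by metis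
      then show ?thesis
        by auto
    qed
    with not_sub \<open>b = 0\<close> show False
      by auto
  qed
  then consider "b > 0" | "b < 0"
    by linarith
  then show thesis
  proof cases
    case 1
    then have "a \<bullet> y \<le> b" if "y \<in> K \<union> L" for y
      using supp K(1) L that by (force simp: supports_at_def)
    then show thesis
      using that[of a] b by auto
  next
    case 2
    then have "a \<bullet> y \<ge> b" if "y \<in> K \<union> L" for y
      using supp K(1) L that by (force simp: supports_at_def)
    then show thesis
      using that[of "- a"] b by auto
  qed
qed

text \<open>
  The definiteness of \<open>g\<close> says that the origin is interior to \<open>L\<close>. Without it a normal \<open>x\<close> on which
  both \<open>f\<close> and \<open>g\<close> vanish would admit every \<open>\<mu> \<noteq> 0\<close> as an eigenvalue, but the hyperplane with that
  normal contains both sets and so gives no contact.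
\<close>

lemma Contact_eq_nonzero_eigenvalues:
  fixes K L :: "'a::euclidean_space set"
  assumes f: "support_function K f" and g: "support_function L g"
    and K: "compact K" "convex K" "uminus ` K = K"
    and L: "compact L" "convex L" "uminus ` L = L"
    and g_pos: "\<And>x. x \<noteq> 0 \<Longrightarrow> g x > 0"
  shows "Contact K L = nonzero_eigenvalues f g"
proof -
  have zero: "0 \<in> K" "0 \<in> L"
  proof -
    obtain k where "k \<in> K"
      using support_function_attained[OF f, of 0] .
    with K show "0 \<in> K"
      by (intro zero_in_symmetric_convex) auto
    obtain l where "l \<in> L"
      using support_function_attained[OF g, of 0] .
    with L show "0 \<in> L"
      by (intro zero_in_symmetric_convex) auto
  qed
  note sub_f = subdifferential_support_function[OF f compact_imp_closed[OF K(1)] K(2)]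
  note sub_g = subdifferential_support_function[OF g compact_imp_closed[OF L(1)] L(2)]
  show ?thesis
  proof (intro equalityI subsetI)
    fix \<mu> assume "\<mu> \<in> Contact K L"
    then obtain p a b where "\<mu> > 0"
      and p: "p \<in> rel_frontier K" "p \<in> rel_frontier ((*\<^sub>R) \<mu> ` L)"
      and supp: "supports_at a b K p" "supports_at a b ((*\<^sub>R) \<mu> ` L) p"
      and "\<not> K \<subseteq> {y. a \<bullet> y = b}"
      unfolding Contact_def tangent_at_def by blast
    have "0 \<in> (*\<^sub>R) \<mu> ` L"
      using zero(2) by force
    then obtain x where "x \<noteq> 0" and x: "\<And>y. y \<in> K \<union> (*\<^sub>R) \<mu> ` L \<Longrightarrow> x \<bullet> y \<le> x \<bullet> p"
      using supports_at_outward_normal[OF zero(1) K(3) _ supp \<open>\<not> K \<subseteq> _\<close>] by blast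
    have "p \<in> K" "p \<in> (*\<^sub>R) \<mu> ` L"
      using p K(1) compact_scaling[OF L(1), of \<mu>]
      by (auto simp: rel_frontier_def compact_imp_closed closure_closed)
    then obtain s where s: "s \<in> L" "p = \<mu> *\<^sub>R s"
      by blast
    have "p \<bullet> x = f x"
    proof (rule antisym)
      show "p \<bullet> x \<le> f x"
        using support_function_ge[OF f \<open>p \<in> K\<close>] .
      show "f x \<le> p \<bullet> x"
        by (rule support_function_attained[OF f, of x]) (use x in \<open>force simp: inner_commute\<close>)
    qed
    moreover have "s \<bullet> x = g x"
    proof (rule antisym)
      show "s \<bullet> x \<le> g x"
        using support_function_ge[OF g \<open>s \<in> L\<close>] .
      obtain l where l: "l \<in> L" "l \<bullet> x = g x"
        using support_function_attained[OF g] .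
      then have "x \<bullet> (\<mu> *\<^sub>R l) \<le> x \<bullet> (\<mu> *\<^sub>R s)"
        using x s(2) by blast
      then show "g x \<le> s \<bullet> x"
        using l(2) \<open>\<mu> > 0\<close> by (simp add: inner_commute)
    qed
    ultimately have "p \<in> subdifferential f x \<inter> (*\<^sub>R) \<mu> ` subdifferential g x"
      using \<open>p \<in> K\<close> s by (auto simp: sub_f sub_g)
    with \<open>x \<noteq> 0\<close> \<open>\<mu> > 0\<close> show "\<mu> \<in> nonzero_eigenvalues f g"
      unfolding nonzero_eigenvalues_def by blast
  next
    fix \<mu> assume "\<mu> \<in> nonzero_eigenvalues f g"
    then obtain x s where "\<mu> \<noteq> 0" "x \<noteq> 0" and p: "\<mu> *\<^sub>R s \<in> K" "(\<mu> *\<^sub>R s) \<bullet> x = f x"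
      and s: "s \<in> L" "s \<bullet> x = g x"
      unfolding nonzero_eigenvalues_def sub_f sub_g by blast
    have "f x \<ge> 0"
      using support_function_ge[OF f zero(1)] by simp
    then have "\<mu> \<ge> 0"
      using p(2)[symmetric] s(2) g_pos[OF \<open>x \<noteq> 0\<close>] by (auto simp: zero_le_mult_iff)
    with \<open>\<mu> \<noteq> 0\<close> have "\<mu> > 0"
      by simp
    have pos: "x \<bullet> (\<mu> *\<^sub>R s) > 0"
      using \<open>\<mu> > 0\<close> s(2) g_pos[OF \<open>x \<noteq> 0\<close>] by (simp add: inner_commute)
    have K_le: "x \<bullet> y \<le> x \<bullet> (\<mu> *\<^sub>R s)" if "y \<in> K" for y
      using support_function_ge[OF f that, of x] p(2) by (metis inner_commute)
    have L_le: "x \<bullet> y \<le> x \<bullet> (\<mu> *\<^sub>R s)" if "y \<in> (*\<^sub>R) \<mu> ` L" for y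
      using that support_function_ge[OF g, of _ x] s(2) \<open>\<mu> > 0\<close> by (auto simp: inner_commute)
    have zero_L: "0 \<in> (*\<^sub>R) \<mu> ` L"
      using zero(2) by force
    have "tangent_at K ((*\<^sub>R) \<mu> ` L) (\<mu> *\<^sub>R s)"
      unfolding tangent_at_def
    proof (intro conjI exI)
      show "\<mu> *\<^sub>R s \<in> rel_frontier K \<inter> rel_frontier ((*\<^sub>R) \<mu> ` L)"
        using rel_frontier_supporting_hyperplane[OF K(2) zero(1) p(1) K_le pos]
          rel_frontier_supporting_hyperplane[OF convex_scaling[OF L(2)] zero_L _ L_le pos] s(1)
        by auto
      show "supports_at x (x \<bullet> (\<mu> *\<^sub>R s)) K (\<mu> *\<^sub>R s)"
        using K_le \<open>x \<noteq> 0\<close> unfolding supports_at_def by blast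
      show "supports_at x (x \<bullet> (\<mu> *\<^sub>R s)) ((*\<^sub>R) \<mu> ` L) (\<mu> *\<^sub>R s)"
        using L_le \<open>x \<noteq> 0\<close> unfolding supports_at_def by blast
      show "\<not> K \<subseteq> {y. x \<bullet> y = x \<bullet> (\<mu> *\<^sub>R s)}"
        using zero(1) pos by force
      show "\<not> (*\<^sub>R) \<mu> ` L \<subseteq> {y. x \<bullet> y = x \<bullet> (\<mu> *\<^sub>R s)}"
        using zero_L pos by force
    qed
    with \<open>\<mu> > 0\<close> show "\<mu> \<in> Contact K L"
      unfolding Contact_def by blast
  qed
qed

section \<open>Duality of eigenvalues\<close>

text \<open>
  The condition is stated for \<open>N\<close> as the support function of the unit ball of \<open>N'\<close>, which is how
  the duality of norms enters the subdifferential of \<open>N\<close>.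
\<close>

definition dual_norms :: "('a::euclidean_space \<Rightarrow> real) \<Rightarrow> ('a \<Rightarrow> real) \<Rightarrow> bool"
  where "dual_norms N N' \<longleftrightarrow>
    support_function {k. N' k \<le> 1} N \<and> compact {k. N' k \<le> 1} \<and> convex {k. N' k \<le> 1} \<and>
    (\<forall>c x. N (c *\<^sub>R x) = \<bar>c\<bar> * N x) \<and> (\<forall>c x. N' (c *\<^sub>R x) = \<bar>c\<bar> * N' x) \<and> (\<forall>x. x \<noteq> 0 \<longrightarrow> N x > 0)"

text \<open>
  The subgradient of \<open>M \<circ> A\<close> at \<open>x\<close> is \<open>A\<^sup>T y\<close> for a \<open>y\<close> in the dual ball of \<open>M\<close> with
  \<open>y \<bullet> Ax = M (Ax)\<close>; an eigenvalue equates it with \<open>\<mu> s\<close> for \<open>s\<close> in the dual ball of \<open>N\<close> with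
  \<open>s \<bullet> x = N x\<close>. With \<open>x\<close> normalised, all these equalities are the equality cases of the
  inequalities on the right-hand side, which is symmetric under \<open>A \<leftrightarrow> A\<^sup>T\<close>, \<open>x \<leftrightarrow> y\<close>,
  \<open>N \<leftrightarrow> M'\<close> and \<open>M \<leftrightarrow> N'\<close>.
\<close>

lemma nonzero_eigenvalues_dual_norms:
  fixes A :: "real^'n::finite^'m::finite"
  assumes N: "dual_norms N N'" and M: "dual_norms M M'"
  shows "nonzero_eigenvalues (\<lambda>x. M (A *v x)) N =
    {\<mu>. \<mu> > 0 \<and> (\<exists>x y. N x \<le> 1 \<and> M' y \<le> 1 \<and> M (A *v x) \<le> \<mu> \<and> N' (transpose A *v y) \<le> \<mu> \<and>
      y \<bullet> (A *v x) = \<mu>)}"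
    (is "_ = ?critical")
proof -
  have supp_N: "support_function {k. N' k \<le> 1} N" and supp_M: "support_function {k. M' k \<le> 1} M"
    and N_scale: "\<And>c x. N (c *\<^sub>R x) = \<bar>c\<bar> * N x" and N'_scale: "\<And>c x. N' (c *\<^sub>R x) = \<bar>c\<bar> * N' x"
    and M_scale: "\<And>c x. M (c *\<^sub>R x) = \<bar>c\<bar> * M x" and N_pos: "\<And>x. x \<noteq> 0 \<Longrightarrow> N x > 0"
    and cpt: "compact {k. N' k \<le> 1}" "compact {k. M' k \<le> 1}"
    and cvx: "convex {k. N' k \<le> 1}" "convex {k. M' k \<le> 1}"
    using N M by (simp_all add: dual_norms_def)
  have M_nonneg: "M x \<ge> 0" for x
    using M M_scale[of 0 0] by (cases "x = 0") (force simp: dual_norms_def)+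
  let ?dual_ball = "(*v) (transpose A) ` {k. M' k \<le> 1}"
  have "compact ?dual_ball" "convex ?dual_ball"
    by (intro compact_matrix_image cpt convex_linear_image matrix_vector_mul_linear cvx)+
  then have sub_MA: "subdifferential (\<lambda>x. M (A *v x)) x =
      {g \<in> ?dual_ball. g \<bullet> x = M (A *v x)}" for x
    by (intro subdifferential_support_function support_function_linear_image supp_M
        compact_imp_closed)
  have sub_N: "subdifferential N x = {s. N' s \<le> 1 \<and> s \<bullet> x = N x}" for x
    using subdifferential_support_function[OF supp_N compact_imp_closed[OF cpt(1)] cvx(1)] by simp
  show ?thesis
  proof (intro equalityI subsetI)
    fix \<mu> assume "\<mu> \<in> nonzero_eigenvalues (\<lambda>x. M (A *v x)) N"
    then obtain x g where "\<mu> \<noteq> 0" "x \<noteq> 0"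
      and g: "g \<in> subdifferential (\<lambda>x. M (A *v x)) x" "g \<in> (*\<^sub>R) \<mu> ` subdifferential N x"
      unfolding nonzero_eigenvalues_def by blast
    obtain y where y: "M' y \<le> 1" "g = transpose A *v y" "g \<bullet> x = M (A *v x)"
      using g(1) unfolding sub_MA by blast
    obtain s where s: "N' s \<le> 1" "s \<bullet> x = N x" "g = \<mu> *\<^sub>R s"
      using g(2) unfolding sub_N by blast
    have MA: "M (A *v x) = \<mu> * N x"
      using y(3) s(2,3) by simp
    have Nx: "N x > 0"
      using N_pos \<open>x \<noteq> 0\<close> .
    then have "\<mu> > 0"
      using MA M_nonneg[of "A *v x"] \<open>\<mu> \<noteq> 0\<close> by (auto simp: zero_le_mult_iff)
    let ?x = "inverse (N x) *\<^sub>R x"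
    have "N ?x \<le> 1" "M (A *v ?x) \<le> \<mu>" "y \<bullet> (A *v ?x) = \<mu>"
      using Nx MA y(2,3)
      by (simp_all add: N_scale M_scale matrix_vector_mult_scaleR dot_lmul_matrix field_simps)
    moreover have "N' (transpose A *v y) \<le> \<mu>"
      using s(1) \<open>\<mu> > 0\<close> unfolding y(2)[symmetric] s(3) by (simp add: N'_scale)
    ultimately show "\<mu> \<in> ?critical"
      using \<open>\<mu> > 0\<close> y(1) by blast
  next
    fix \<mu> assume "\<mu> \<in> ?critical"
    then obtain x y where "\<mu> > 0" and x: "N x \<le> 1" and y: "M' y \<le> 1" and MA: "M (A *v x) \<le> \<mu>"
      and NA: "N' (transpose A *v y) \<le> \<mu>" and eq: "y \<bullet> (A *v x) = \<mu>"
      by blast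
    let ?s = "inverse \<mu> *\<^sub>R (transpose A *v y)"
    have "x \<noteq> 0"
      using eq \<open>\<mu> > 0\<close> by auto
    have s1: "N' ?s \<le> 1"
      using NA \<open>\<mu> > 0\<close> by (simp add: N'_scale field_simps)
    have s2: "?s \<bullet> x = 1"
      using eq \<open>\<mu> > 0\<close> by (simp add: dot_lmul_matrix)
    with s1 x have "?s \<bullet> x = N x"
      using support_function_ge[OF supp_N, of ?s x] by simp
    with s1 have "?s \<in> subdifferential N x"
      by (simp add: sub_N)
    moreover have "y \<bullet> (A *v x) = M (A *v x)"
      using support_function_ge[OF supp_M, of y "A *v x"] y MA eq by simp
    then have "transpose A *v y \<in> subdifferential (\<lambda>x. M (A *v x)) x"
      using y by (simp add: sub_MA dot_lmul_matrix)
    moreover have "transpose A *v y = \<mu> *\<^sub>R ?s"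
      using \<open>\<mu> > 0\<close> by simp
    ultimately have "subdifferential (\<lambda>x. M (A *v x)) x \<inter> (*\<^sub>R) \<mu> ` subdifferential N x \<noteq> {}"
      by (metis IntI empty_iff imageI)
    with \<open>\<mu> > 0\<close> \<open>x \<noteq> 0\<close> show "\<mu> \<in> nonzero_eigenvalues (\<lambda>x. M (A *v x)) N"
      unfolding nonzero_eigenvalues_def by auto
  qed
qed

section \<open>The norms of the two Laplacians\<close>

lemma infnorm_le_iff_cart:
  fixes x :: "real^'n::finite"
  shows "infnorm x \<le> r \<longleftrightarrow> (\<forall>i. \<bar>x $ i\<bar> \<le> r)"
  by (auto simp: infnorm_Max Basis_vec_def inner_axis)

lemma cbox_eq_infnorm_ball: "cbox (- 1) 1 = {x :: real^'n::finite. infnorm x \<le> 1}"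
  by (auto simp: set_eq_iff mem_box_cart infnorm_le_iff_cart abs_le_iff minus_le_iff)

lemma infnorm_attained_cart:
  fixes x :: "real^'n::finite"
  obtains i where "infnorm x = \<bar>x $ i\<bar>"
proof -
  have "infnorm x \<in> (\<lambda>b. \<bar>x \<bullet> b\<bar>) ` Basis"
    unfolding infnorm_Max by (intro Max_in) auto
  then show thesis
    using that by (auto simp: Basis_vec_def inner_axis)
qed

lemma l1_norm_scaleR: "l1_norm (c *\<^sub>R x) = \<bar>c\<bar> * l1_norm x"
  by (simp add: l1_norm_def abs_mult sum_distrib_left)

lemma inner_le_infnorm_l1_norm: "x \<bullet> y \<le> infnorm x * l1_norm y"
proof -
  have "x \<bullet> y \<le> (\<Sum>i\<in>UNIV. \<bar>x $ i\<bar> * \<bar>y $ i\<bar>)"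
    unfolding inner_vec_def by (intro sum_mono) (simp flip: abs_mult)
  also have "\<dots> \<le> (\<Sum>i\<in>UNIV. infnorm x * \<bar>y $ i\<bar>)"
    by (intro sum_mono mult_right_mono component_le_infnorm_cart) auto
  finally show ?thesis
    by (simp add: l1_norm_def sum_distrib_left)
qed

lemma l1_norm_nonneg: "l1_norm x \<ge> 0"
  by (simp add: l1_norm_def sum_nonneg)

lemma l1_norm_pos: "x \<noteq> 0 \<Longrightarrow> l1_norm x > 0"
  using norm_le_l1_cart[of x] unfolding l1_norm_def by (smt (verit) zero_less_norm_iff)

text \<open>The maximum over the cube is attained at the vector of signs of \<open>x\<close>.\<close>

lemma support_function_cube: "support_function {k. infnorm k \<le> 1} l1_norm"
  unfolding support_function_def
proof (intro allI conjI ballI)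
  fix x k :: "real^'a" assume "k \<in> {k. infnorm k \<le> 1}"
  then show "k \<bullet> x \<le> l1_norm x"
    using inner_le_infnorm_l1_norm[of k x] mult_right_mono[of "infnorm k" 1 "l1_norm x"]
      l1_norm_nonneg[of x] by simp
next
  fix x :: "real^'a"
  have "infnorm (\<chi> i. sgn (x $ i)) \<le> 1"
    by (simp add: infnorm_le_iff_cart abs_sgn_eq)
  moreover have "(\<chi> i. sgn (x $ i)) \<bullet> x = l1_norm x"
    by (simp add: inner_vec_def l1_norm_def abs_sgn mult.commute)
  ultimately show "\<exists>k\<in>{k. infnorm k \<le> 1}. k \<bullet> x = l1_norm x"
    by blast
qed

text \<open>The maximum over the cross-polytope is attained at a vertex, a signed unit vector.\<close>

lemma support_function_cross_polytope: "support_function {k. l1_norm k \<le> 1} infnorm"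
  unfolding support_function_def
proof (intro allI conjI ballI)
  fix x k :: "real^'a" assume "k \<in> {k. l1_norm k \<le> 1}"
  then show "k \<bullet> x \<le> infnorm x"
    using inner_le_infnorm_l1_norm[of x k] mult_left_mono[of "l1_norm k" 1 "infnorm x"]
      infnorm_pos_le[of x] by (simp add: inner_commute)
next
  fix x :: "real^'a"
  obtain i where i: "infnorm x = \<bar>x $ i\<bar>"
    by (rule infnorm_attained_cart)
  have "l1_norm (axis i (sgn (x $ i))) = \<bar>sgn (x $ i)\<bar>"
    by (simp add: l1_norm_def axis_def if_distrib cong: if_cong)
  then have "l1_norm (axis i (sgn (x $ i))) \<le> 1"
    by (simp add: abs_sgn_eq)
  moreover have "axis i (sgn (x $ i)) \<bullet> x = infnorm x"
    by (simp add: i inner_axis' abs_sgn mult.commute)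
  ultimately show "\<exists>k\<in>{k. l1_norm k \<le> 1}. k \<bullet> x = infnorm x"
    by blast
qed

lemma dual_norms_l1_norm_infnorm: "dual_norms l1_norm (infnorm :: real^'n::finite \<Rightarrow> real)"
  unfolding dual_norms_def
  using support_function_cube l1_norm_scaleR infnorm_mul l1_norm_pos
  by (auto simp flip: cbox_eq_infnorm_ball)

lemma dual_norms_infnorm_l1_norm: "dual_norms infnorm (l1_norm :: real^'n::finite \<Rightarrow> real)"
  unfolding dual_norms_def
proof (intro conjI allI impI)
  show "compact {k :: real^'n. l1_norm k \<le> 1}"
    unfolding compact_eq_bounded_closed
  proof
    show "bounded {k :: real^'n. l1_norm k \<le> 1}"
      unfolding bounded_iff l1_norm_def using norm_le_l1_cart order_trans by blast
    show "closed {k :: real^'n. l1_norm k \<le> 1}"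
      unfolding l1_norm_def by (intro closed_Collect_le continuous_intros)
  qed
  show "convex {k :: real^'n. l1_norm k \<le> 1}"
  proof (rule convexI; clarify)
    fix x y :: "real^'n" and u v :: real
    assume *: "l1_norm x \<le> 1" "l1_norm y \<le> 1" "0 \<le> u" "0 \<le> v" "u + v = 1"
    have "l1_norm (u *\<^sub>R x + v *\<^sub>R y) \<le> l1_norm (u *\<^sub>R x) + l1_norm (v *\<^sub>R y)"
      unfolding l1_norm_def sum.distrib[symmetric] by (intro sum_mono) (simp add: abs_triangle_ineq)
    also have "\<dots> = u * l1_norm x + v * l1_norm y"
      using * by (simp add: l1_norm_scaleR)
    also have "\<dots> \<le> 1"
      using * by (intro convex_bound_le)
    finally show "l1_norm (u *\<^sub>R x + v *\<^sub>R y) \<le> 1" .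
  qed
qed (use support_function_cross_polytope l1_norm_scaleR infnorm_mul in \<open>auto simp: infnorm_pos_lt\<close>)

section \<open>The hypergraphic zonotope\<close>

lemma closed_segment_minus_eq:
  fixes v :: "'a::real_vector"
  shows "closed_segment (- v) v = (\<lambda>t. t *\<^sub>R v) ` {-1..1}"
proof -
  have "closed_segment (- v) v = (\<lambda>t. t *\<^sub>R v) ` closed_segment (- 1) 1"
    using closed_segment_linear_image[of "\<lambda>t. t *\<^sub>R v" "- 1" 1]
    by (simp add: linear_scale_left)
  then show ?thesis
    by (simp add: closed_segment_eq_real_ivl)
qed

lemma hypergraphic_zonotope_eq_image_cube: "hypergraphic_zonotope w = (*v) w ` cbox (- 1) 1"
proof -
  have mult: "w *v t = (\<Sum>h\<in>UNIV. t $ h *\<^sub>R column h w)" for t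
    by (simp add: matrix_mult_sum scalar_mult_eq_scaleR)
  show ?thesis
    unfolding hypergraphic_zonotope_def set_sum_alt[OF finite_class.finite_UNIV]
  proof (intro equalityI subsetI; clarify)
    fix s assume "\<forall>h\<in>UNIV. s h \<in> closed_segment (- column h w) (column h w)"
    then have "\<forall>h. \<exists>t\<in>{-1..1}. s h = t *\<^sub>R column h w"
      by (auto simp: closed_segment_minus_eq)
    then obtain t where "\<And>h. t h \<in> {-1..1}" "\<And>h. s h = t h *\<^sub>R column h w"
      by metis
    then show "sum s UNIV \<in> (*v) w ` cbox (- 1) 1"
      by (intro image_eqI[of _ _ "\<chi> h. t h"]) (auto simp: mult mem_box_cart)
  next
    fix t :: "real^'b" assume "t \<in> cbox (- 1) 1"
    then show "\<exists>s. w *v t = sum s UNIV \<and>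
        (\<forall>h\<in>UNIV. s h \<in> closed_segment (- column h w) (column h w))"
      by (intro exI[of _ "\<lambda>h. t $ h *\<^sub>R column h w"])
        (auto simp: mult mem_box_cart closed_segment_minus_eq)
  qed
qed

theorem theorem70:
  fixes w :: "('v::finite, 'h::finite) hypergraph"
  shows "Contact (hypergraphic_zonotope w) (cbox (- 1) 1) = nonzero_spec_Laplacian_1 w \<and>
    nonzero_spec_Laplacian_1 w = nonzero_spec_Laplacian_infinity (dual_hypergraph w)"
proof
  have spec_1: "nonzero_spec_Laplacian_1 w =
      nonzero_eigenvalues (\<lambda>x. l1_norm (transpose w *v x)) l1_norm"
    by (simp add: nonzero_spec_Laplacian_1_def nonzero_eigenvalues_def edge_vertex_matrix_def)
  have spec_infinity: "nonzero_spec_Laplacian_infinity (dual_hypergraph w) =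
      nonzero_eigenvalues (\<lambda>y. infnorm (w *v y)) infnorm"
    by (simp add: nonzero_spec_Laplacian_infinity_def nonzero_eigenvalues_def
        edge_vertex_matrix_def dual_hypergraph_def)
  show "Contact (hypergraphic_zonotope w) (cbox (- 1) 1) = nonzero_spec_Laplacian_1 w"
    unfolding spec_1
  proof (rule Contact_eq_nonzero_eigenvalues)
    show "support_function (hypergraphic_zonotope w) (\<lambda>x. l1_norm (transpose w *v x))"
      using support_function_linear_image[OF support_function_cube, of "transpose w"]
      by (simp add: hypergraphic_zonotope_eq_image_cube cbox_eq_infnorm_ball)
    show "support_function (cbox (- 1) 1) (l1_norm :: real^'v \<Rightarrow> real)"
      by (simp add: cbox_eq_infnorm_ball support_function_cube)
    show "compact (hypergraphic_zonotope w)" "convex (hypergraphic_zonotope w)"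
      unfolding hypergraphic_zonotope_eq_image_cube
      by (intro compact_matrix_image compact_cbox convex_linear_image matrix_vector_mul_linear
          convex_box)+
    have "uminus ` (*v) w ` cbox (- 1) 1 = (*v) w ` uminus ` cbox (- 1) 1"
      by (simp only: image_image linear_neg[OF matrix_vector_mul_linear])
    then show "uminus ` hypergraphic_zonotope w = hypergraphic_zonotope w"
      by (simp add: hypergraphic_zonotope_eq_image_cube)
  qed (auto simp: l1_norm_pos)
  have swap: "y \<bullet> (transpose w *v x) = x \<bullet> (w *v y)" for x y
    by (metis dot_lmul_matrix inner_commute transpose_matrix_vector)
  show "nonzero_spec_Laplacian_1 w = nonzero_spec_Laplacian_infinity (dual_hypergraph w)"
    unfolding spec_1 spec_infinity
      nonzero_eigenvalues_dual_norms[OF dual_norms_l1_norm_infnorm dual_norms_l1_norm_infnorm]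
      nonzero_eigenvalues_dual_norms[OF dual_norms_infnorm_l1_norm dual_norms_infnorm_l1_norm]
    unfolding transpose_transpose swap by blast
qed

end
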